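(* Let $\kappa,\lambda>0$ and $V(r)=\frac{\kappa}{r}+\frac{\lambda}{r^2}$ for $r>0$ (Levi-Civita potential). Let $\Lambda$, $T$ and $\Theta$ be the domain, radial period and apsidal angle defined in the context. Then for all $(H,L)\in\Lambda$, $$\partial_HT(H,L)\,\partial_L\Theta(H,L)-\partial_LT(H,L)\,\partial_H\Theta(H,L)=-\frac{3\sqrt2\,\pi^2\kappa\lambda}{(-H)^{5/2}(L^2-2\lambda)^{3/2}}<0 .$$
   Context: For $L>\sqrt{2\lambda}$ let $W(r;L)=\frac{L^2}{2r^2}-\frac{\kappa}{r}-\frac{\lambda}{r^2}$, $r>0$. It has a unique strict global minimum point $r_0(L)=\frac{L^2-2\lambda}{\kappa}$ with minimum value $-\frac{\kappa^2}{2(L^2-2\lambda)}$. Let $$\Lambda=\Big\{(H,L)\in\mathbb{R}^2:\ L>\sqrt{2\lambda},\ -\frac{\kappa^2}{2(L^2-2\lambda)}<H<0\Big\}.$$ For $(H,L)\in\Lambda$ the equation $W(r;L)=H$ has exactly two solutions $r_-(H,L)<r_0(L)<r_+(H,L)$, and $$T(H,L)=\sqrt2\int_{r_-(H,L)}^{r_+(H,L)}\frac{dr}{\sqrt{H-W(r;L)}},\qquad\Theta(H,L)=\sqrt2\,L\int_{r_-(H,L)}^{r_+(H,L)}\frac{dr}{r^2\sqrt{H-W(r;L)}}.$$ *)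

theory Defs
  imports "HOL-Analysis.Analysis"
begin

definition levi_civita_V :: "real \<Rightarrow> real \<Rightarrow> real \<Rightarrow> real" where
  "levi_civita_V \<kappa> lam r = \<kappa> / r + lam / r\<^sup>2"

definition eff_W :: "real \<Rightarrow> real \<Rightarrow> real \<Rightarrow> real \<Rightarrow> real" where
  "eff_W \<kappa> lam L r = L\<^sup>2 / (2 * r\<^sup>2) - levi_civita_V \<kappa> lam r"

definition r_zero :: "real \<Rightarrow> real \<Rightarrow> real \<Rightarrow> real" where
  "r_zero \<kappa> lam L = (L\<^sup>2 - 2 * lam) / \<kappa>"

definition Lambda_dom :: "real \<Rightarrow> real \<Rightarrow> (real \<times> real) set" where
  "Lambda_dom \<kappa> lam = {(H, L). L > sqrt (2 * lam) \<and> - (\<kappa>\<^sup>2 / (2 * (L\<^sup>2 - 2 * lam))) < H \<and> H < 0}"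

definition r_minus :: "real \<Rightarrow> real \<Rightarrow> real \<Rightarrow> real \<Rightarrow> real" where
  "r_minus \<kappa> lam H L = (THE r. 0 < r \<and> r < r_zero \<kappa> lam L \<and> eff_W \<kappa> lam L r = H)"

definition r_plus :: "real \<Rightarrow> real \<Rightarrow> real \<Rightarrow> real \<Rightarrow> real" where
  "r_plus \<kappa> lam H L = (THE r. r_zero \<kappa> lam L < r \<and> eff_W \<kappa> lam L r = H)"

text \<open>The integrands are singular at both endpoints, where division by zero gives the value 0;
  this does not affect the Henstock--Kurzweil integral, which also covers improper integrals.\<close>

definition radial_period :: "real \<Rightarrow> real \<Rightarrow> real \<Rightarrow> real \<Rightarrow> real" where
  "radial_period \<kappa> lam H L =
     sqrt 2 * integral {r_minus \<kappa> lam H L..r_plus \<kappa> lam H L} (\<lambda>r. 1 / sqrt (H - eff_W \<kappa> lam L r))"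

definition apsidal_angle :: "real \<Rightarrow> real \<Rightarrow> real \<Rightarrow> real \<Rightarrow> real" where
  "apsidal_angle \<kappa> lam H L =
     sqrt 2 * L * integral {r_minus \<kappa> lam H L..r_plus \<kappa> lam H L}
       (\<lambda>r. 1 / (r\<^sup>2 * sqrt (H - eff_W \<kappa> lam L r)))"

text \<open>The descriptions defining \<open>r_minus\<close> and \<open>r_plus\<close> are proper, and there are no further
  solutions: the minimum point itself is not one.\<close>

lemma turning_points:
  fixes \<kappa> lam H L :: real
  assumes "\<kappa> > 0" "lam > 0" and "(H, L) \<in> Lambda_dom \<kappa> lam"
  shows "\<exists>!r. 0 < r \<and> r < r_zero \<kappa> lam L \<and> eff_W \<kappa> lam L r = H"
    and "\<exists>!r. r_zero \<kappa> lam L < r \<and> eff_W \<kappa> lam L r = H"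
    and "0 < r_zero \<kappa> lam L"
    and "eff_W \<kappa> lam L (r_zero \<kappa> lam L) \<noteq> H"
proof -
  define m where "m = L\<^sup>2 - 2 * lam"
  define h where "h = - H"
  define d where "d = sqrt (\<kappa>\<^sup>2 - 2 * h * m)"
  define a where "a = (\<kappa> - d) / (2 * h)"
  define b where "b = (\<kappa> + d) / (2 * h)"
  have L: "sqrt (2 * lam) < L" and H: "- (\<kappa>\<^sup>2 / (2 * m)) < H" and h0: "0 < h"
    using assms(3) by (auto simp: Lambda_dom_def m_def h_def)
  have "(sqrt (2 * lam))\<^sup>2 < L\<^sup>2"
    using L assms(2) by (intro power_strict_mono) auto
  then have m0: "0 < m" using assms(2) by (simp add: m_def)
  have "h < \<kappa>\<^sup>2 / (2 * m)" using H by (simp add: h_def)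
  then have hm: "2 * h * m < \<kappa>\<^sup>2" using m0 by (simp add: field_simps)
  have d2: "d\<^sup>2 = \<kappa>\<^sup>2 - 2 * h * m" and d0: "0 < d" using hm by (auto simp: d_def)
  have "d\<^sup>2 < \<kappa>\<^sup>2" using d2 h0 m0 by simp
  then have dk: "d < \<kappa>" using assms(1) power2_less_imp_less by fastforce
  have a0: "0 < a" using dk h0 by (simp add: a_def)
  have z: "r_zero \<kappa> lam L = m / \<kappa>" by (simp add: r_zero_def m_def)
  have ab: "a * b = m / (2 * h)"
  proof -
    have "a * b = (\<kappa>\<^sup>2 - d\<^sup>2) / (4 * h\<^sup>2)"
      by (simp add: a_def b_def algebra_simps power2_eq_square)
    also have "\<dots> = m / (2 * h)" using h0 unfolding d2 by (simp add: power2_eq_square)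
    finally show ?thesis .
  qed
  have s: "a + b = \<kappa> / h" using h0 by (simp add: a_def b_def field_simps)
  have mk: "m / \<kappa> = 2 * (a * b) / (a + b)"
    unfolding ab s using h0 assms(1) by (simp add: field_simps)
  have lt: "a < b" using d0 h0 by (simp add: a_def b_def divide_strict_right_mono)
  have "a * a < a * b" and "a * b < b * b" using a0 lt by simp_all
  then have az: "a < m / \<kappa>" and bz: "m / \<kappa> < b"
    unfolding mk using a0 lt by (simp_all add: field_simps)
  have root: "eff_W \<kappa> lam L r = H \<longleftrightarrow> r = a \<or> r = b" if "0 < r" for r
  proof -
    have "eff_W \<kappa> lam L r = H \<longleftrightarrow> m / 2 - \<kappa> * r + h * r\<^sup>2 = 0"
      using that unfolding eff_W_def levi_civita_V_def m_def h_def
      by (auto simp: field_simps power2_eq_square)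
    also have "m / 2 - \<kappa> * r + h * r\<^sup>2 = h * ((r - a) * (r - b))"
    proof -
      have "h * ((r - a) * (r - b)) = h * r\<^sup>2 - h * (a + b) * r + h * (a * b)"
        by (simp add: algebra_simps power2_eq_square)
      then show ?thesis unfolding ab s using h0 by simp
    qed
    finally show ?thesis using h0 by simp
  qed
  show pos: "0 < r_zero \<kappa> lam L" using z m0 assms(1) by simp
  show "\<exists>!r. 0 < r \<and> r < r_zero \<kappa> lam L \<and> eff_W \<kappa> lam L r = H"
  proof (rule ex1I[of _ a])
    show "0 < a \<and> a < r_zero \<kappa> lam L \<and> eff_W \<kappa> lam L a = H"
      using root[OF a0] a0 az z by simp
    show "r = a" if "0 < r \<and> r < r_zero \<kappa> lam L \<and> eff_W \<kappa> lam L r = H" for r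
      using root[of r] that bz z by auto
  qed
  show "\<exists>!r. r_zero \<kappa> lam L < r \<and> eff_W \<kappa> lam L r = H"
  proof (rule ex1I[of _ b])
    show "r_zero \<kappa> lam L < b \<and> eff_W \<kappa> lam L b = H"
      using root[of b] a0 lt bz z by simp
    show "r = b" if "r_zero \<kappa> lam L < r \<and> eff_W \<kappa> lam L r = H" for r
      using root[of r] that az z pos by auto
  qed
  show "eff_W \<kappa> lam L (r_zero \<kappa> lam L) \<noteq> H"
    using root[OF pos] az bz z by auto
qed

end

theory Submission
  imports Defs
begin

text \<open>With \<open>p < q\<close> the turning points, \<open>H - W(r) = (-H) (r - p) (q - r) / r\<^sup>2\<close>, so both
  integrals have arcsine primitives. By Vieta, \<open>T = (sqrt 2 / 2) \<pi> \<kappa> (-H) powr (-3/2)\<close>, which does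
  not depend on \<open>L\<close>, and \<open>\<Theta> = 2 \<pi> L (L\<^sup>2 - 2 \<lambda>) powr (-1/2)\<close>, which does not depend on \<open>H\<close>. The
  Jacobian is therefore the single product of \<open>\<partial>T/\<partial>H\<close> and \<open>\<partial>\<Theta>/\<partial>L\<close>.\<close>

section \<open>Two arcsine integrals over an interval\<close>

lemma has_integral_arcsin_first_moment:
  fixes a b :: real
  assumes "a < b"
  shows "((\<lambda>r. r / sqrt ((r - a) * (b - r))) has_integral pi * (a + b) / 2) {a..b}"
proof -
  \<comment> \<open>Splitting the numerator as \<open>r = (r - (a + b) / 2) + (a + b) / 2\<close>
    gives the two terms of this primitive. The root vanishes at both ends, while the arcsine, taken
    of the affine map from \<open>{a..b}\<close> onto \<open>{-1..1}\<close>, grows by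
    \<open>pi\<close>.\<close>
  define F where "F r = - sqrt ((r - a) * (b - r)) + (a + b) / 2 * arcsin ((2 * r - a - b) / (b - a))" for r
  have cont: "continuous_on {a..b} F"
    unfolding F_def using assms
    by (intro continuous_intros) (auto simp: field_simps)
  have deriv: "(F has_vector_derivative r / sqrt ((r - a) * (b - r))) (at r)" if "r \<in> {a<..<b}" for r
  proof -
    define x where "x = (2 * r - a - b) / (b - a)"
    define s where "s = sqrt ((r - a) * (b - r))"
    have prod: "(r - a) * (b - r) > 0" using that by simp
    then have s: "s > 0" by (simp add: s_def)
    have x: "- 1 < x" "x < 1" using that by (auto simp: x_def field_simps)
    \<comment> \<open>Product of \<open>1 - x = 2 * (b - r) / (b - a)\<close> and
      \<open>1 + x = 2 * (r - a) / (b - a)\<close>.\<close>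
    have "1 - x\<^sup>2 = 4 * ((r - a) * (b - r)) / (b - a)\<^sup>2"
      using assms by (simp add: x_def divide_simps) (simp add: algebra_simps power2_eq_square)
    then have sx: "sqrt (1 - x\<^sup>2) = 2 * s / (b - a)"
      using assms by (simp add: s_def real_sqrt_divide real_sqrt_mult)
    have 1: "((\<lambda>r. sqrt ((r - a) * (b - r))) has_real_derivative ((a + b) / 2 - r) / s) (at r)"
      unfolding s_def using prod by (auto intro!: derivative_eq_intros simp: field_simps)
    have 2: "((\<lambda>r. (2 * r - a - b) / (b - a)) has_real_derivative 2 / (b - a)) (at r)"
      by (rule DERIV_cdivide) (auto intro!: derivative_eq_intros)
    have "((\<lambda>r. arcsin ((2 * r - a - b) / (b - a))) has_real_derivative
        inverse (sqrt (1 - x\<^sup>2)) * (2 / (b - a))) (at r)"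
      using DERIV_chain2[OF DERIV_arcsin[OF x, unfolded x_def] 2] by (simp add: x_def)
    also have "inverse (sqrt (1 - x\<^sup>2)) * (2 / (b - a)) = 1 / s"
      unfolding sx using assms s by (simp add: field_simps)
    finally have 3: "((\<lambda>r. arcsin ((2 * r - a - b) / (b - a))) has_real_derivative 1 / s) (at r)" .
    have "(F has_real_derivative - (((a + b) / 2 - r) / s) + (a + b) / 2 * (1 / s)) (at r)"
      unfolding F_def by (intro DERIV_add DERIV_minus DERIV_cmult 1 3)
    also have "- (((a + b) / 2 - r) / s) + (a + b) / 2 * (1 / s) = r / s"
      using s by (simp add: field_simps)
    finally show ?thesis
      unfolding s_def by (simp add: has_real_derivative_iff_has_vector_derivative)
  qed
  \<comment> \<open>The primitive is continuous up to the ends but differentiated only inside, where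
    the integrand is not singular; the interior form of the fundamental theorem asks for no
    more.\<close>
  have "((\<lambda>r. r / sqrt ((r - a) * (b - r))) has_integral F b - F a) {a..b}"
    using assms cont deriv by (intro fundamental_theorem_of_calculus_interior) auto
  moreover have "(2 * b - a - b) / (b - a) = 1" "(2 * a - a - b) / (b - a) = - 1"
    using assms by (auto simp: field_simps)
  then have "F b - F a = pi * (a + b) / 2"
    by (simp add: F_def)
  ultimately show ?thesis by simp
qed

text \<open>The substitution \<open>u = 1 / r\<close> reduces this to a plain arcsine integral. The
  primitive is therefore an arcsine of the affine function of \<open>1 / r\<close> that takes
  \<open>a\<close> to \<open>-1\<close> and \<open>b\<close> to \<open>1\<close>, and the scaling
  leaves the factor \<open>1 / sqrt (a * b)\<close>.\<close>

lemma has_integral_arcsin_inverse_moment: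
  fixes a b :: real
  assumes "0 < a" "a < b"
  shows "((\<lambda>r. 1 / (r * sqrt ((r - a) * (b - r)))) has_integral pi / sqrt (a * b)) {a..b}"
proof -
  define c where "c = sqrt (a * b)"
  have c: "c > 0" "c * c = a * b" using assms by (auto simp: c_def)
  define G where "G r = arcsin ((a + b - 2 * a * b / r) / (b - a)) / c" for r
  have range: "- 1 \<le> (a + b - 2 * a * b / r) / (b - a)" "(a + b - 2 * a * b / r) / (b - a) \<le> 1"
    if "a \<le> r" "r \<le> b" for r
  proof -
    have "a * b \<le> r * b" "a * r \<le> a * b" using that assms by simp_all
    then show "- 1 \<le> (a + b - 2 * a * b / r) / (b - a)" "(a + b - 2 * a * b / r) / (b - a) \<le> 1"
      using that assms by (auto simp: field_simps)
  qed
  have cont: "continuous_on {a..b} G"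
    unfolding G_def using assms c range by (intro continuous_intros) auto
  have deriv: "(G has_vector_derivative 1 / (r * sqrt ((r - a) * (b - r)))) (at r)"
    if "r \<in> {a<..<b}" for r
  proof -
    define x where "x = (a + b - 2 * a * b / r) / (b - a)"
    define s where "s = sqrt ((r - a) * (b - r))"
    have r: "r > 0" using that assms by simp
    have prod: "(r - a) * (b - r) > 0" using that by simp
    then have s: "s > 0" by (simp add: s_def)
    have "a * b < r * b" "a * r < a * b" using that assms by simp_all
    then have x: "- 1 < x" "x < 1" using r assms by (auto simp: x_def field_simps)
    \<comment> \<open>Here \<open>1 - x = 2 * a * (b - r) / ((b - a) * r)\<close> and
      \<open>1 + x = 2 * b * (r - a) / ((b - a) * r)\<close>.\<close>
    have "1 - x\<^sup>2 = 4 * (a * b) * ((r - a) * (b - r)) / ((b - a)\<^sup>2 * r\<^sup>2)"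
      using assms r by (simp add: x_def divide_simps) (simp add: algebra_simps power2_eq_square)
    then have sx: "sqrt (1 - x\<^sup>2) = 2 * c * s / ((b - a) * r)"
      using assms r by (simp add: s_def c_def real_sqrt_divide real_sqrt_mult)
    have 2: "((\<lambda>r. (a + b - 2 * a * b / r) / (b - a)) has_real_derivative 2 * (c * c) / r\<^sup>2 / (b - a)) (at r)"
      unfolding c(2) using assms r
      by (auto intro!: derivative_eq_intros simp: power2_eq_square)
    have "(G has_real_derivative inverse (sqrt (1 - x\<^sup>2)) * (2 * (c * c) / r\<^sup>2 / (b - a)) / c) (at r)"
      unfolding G_def
      using DERIV_cdivide[OF DERIV_chain2[OF DERIV_arcsin[OF x, unfolded x_def] 2], where c = c] by (simp add: x_def)
    also have "inverse (sqrt (1 - x\<^sup>2)) * (2 * (c * c) / r\<^sup>2 / (b - a)) / c = 1 / (r * s)"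
      unfolding sx using assms s r c(1) by (simp add: divide_simps power2_eq_square)
    finally show ?thesis
      unfolding s_def by (simp add: has_real_derivative_iff_has_vector_derivative)
  qed
  have "((\<lambda>r. 1 / (r * sqrt ((r - a) * (b - r)))) has_integral G b - G a) {a..b}"
    using assms cont deriv by (intro fundamental_theorem_of_calculus_interior) auto
  moreover have ends: "(a + b - 2 * a * b / b) / (b - a) = 1" "(a + b - 2 * a * b / a) / (b - a) = - 1"
    using assms by (auto simp: field_simps)
  have "G b - G a = pi / c"
    unfolding G_def ends by simp
  ultimately show ?thesis by (simp add: c_def)
qed

section \<open>The domain and its openness\<close>

text \<open>Clearing the positive denominator leaves strict inequalities between polynomials, from
  which openness can be read off.\<close>

lemma Lambda_dom_iff:
  assumes "lam > 0"
  shows "(H, L) \<in> Lambda_dom \<kappa> lam \<longleftrightarrow>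
    sqrt (2 * lam) < L \<and> 2 * (- H) * (L\<^sup>2 - 2 * lam) < \<kappa>\<^sup>2 \<and> H < 0"
proof -
  have "L\<^sup>2 - 2 * lam > 0" if "sqrt (2 * lam) < L"
    using power_strict_mono[OF that, of 2] assms by simp
  then show ?thesis
    by (auto simp: Lambda_dom_def field_simps)
qed

lemma Lambda_dom_pos:
  assumes "lam > 0" "(H, L) \<in> Lambda_dom \<kappa> lam"
  shows "H < 0" "0 < L" "0 < L\<^sup>2 - 2 * lam"
proof -
  have L: "sqrt (2 * lam) < L" and "H < 0"
    using assms by (auto simp: Lambda_dom_def)
  then show "H < 0" by simp
  show "0 < L" using L assms(1) by (meson less_trans mult_pos_pos real_sqrt_gt_zero zero_less_numeral)
  show "0 < L\<^sup>2 - 2 * lam"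
    using power_strict_mono[OF L, of 2] assms by simp
qed

text \<open>Differentiating the closed forms at a point of the domain requires them to hold in a
  neighbourhood of it.\<close>

lemma open_Lambda_dom:
  assumes "lam > 0"
  shows "open (Lambda_dom \<kappa> lam)"
proof -
  have "Lambda_dom \<kappa> lam = {x. sqrt (2 * lam) < snd x} \<inter>
      {x. 2 * (- fst x) * ((snd x)\<^sup>2 - 2 * lam) < \<kappa>\<^sup>2} \<inter> {x. fst x < 0}"
    using Lambda_dom_iff[OF assms] by auto
  also have "open \<dots>"
    by (intro open_Int open_Collect_less continuous_intros)
  finally show ?thesis .
qed

section \<open>Vieta relations and closed forms for the period and the angle\<close>

text \<open>Multiplied by \<open>r\<^sup>2\<close>, the difference
  \<open>H - eff_W \<kappa> lam L r\<close> becomes a quadratic in \<open>r\<close> whose two roots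
  are the turning points.\<close>

lemma turning_points_factorization:
  fixes \<kappa> lam H L :: real
  defines "p \<equiv> r_minus \<kappa> lam H L" and "q \<equiv> r_plus \<kappa> lam H L"
  assumes "\<kappa> > 0" "lam > 0" "(H, L) \<in> Lambda_dom \<kappa> lam"
  shows "0 < p" "p < q" "- H * (p + q) = \<kappa>" "- H * (p * q) = (L\<^sup>2 - 2 * lam) / 2"
    and "\<And>r. 0 < r \<Longrightarrow> sqrt (H - eff_W \<kappa> lam L r) = sqrt (- H) * sqrt ((r - p) * (q - r)) / r"
proof -
  note tp = turning_points[OF assms(3-5)]
  have p: "0 < p" "p < r_zero \<kappa> lam L" "eff_W \<kappa> lam L p = H"
    using theI'[OF tp(1)] by (auto simp: p_def r_minus_def)
  have q: "r_zero \<kappa> lam L < q" "eff_W \<kappa> lam L q = H"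
    using theI'[OF tp(2)] by (auto simp: q_def r_plus_def)
  show "0 < p" "p < q" using p q by auto
  have W: "H - eff_W \<kappa> lam L r = (H * r\<^sup>2 + \<kappa> * r - (L\<^sup>2 - 2 * lam) / 2) / r\<^sup>2" if "0 < r" for r
    using that by (simp add: eff_W_def levi_civita_V_def field_simps power2_eq_square)
  have ep: "H * p\<^sup>2 + \<kappa> * p - (L\<^sup>2 - 2 * lam) / 2 = 0"
    using W[of p] p by simp
  have eq: "H * q\<^sup>2 + \<kappa> * q - (L\<^sup>2 - 2 * lam) / 2 = 0"
    using W[of q] p q by simp
  \<comment> \<open>Difference of the two root equations; \<open>p < q\<close> then allows
    \<open>q - p\<close> to be cancelled.\<close>
  have "(q - p) * (H * (p + q) + \<kappa>) = 0"
    using ep eq by (simp add: algebra_simps power2_eq_square)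
  then show sum: "- H * (p + q) = \<kappa>"
    using \<open>p < q\<close> by simp
  show prod: "- H * (p * q) = (L\<^sup>2 - 2 * lam) / 2"
    using ep unfolding sum[symmetric] by (simp add: algebra_simps power2_eq_square)
  show "sqrt (H - eff_W \<kappa> lam L r) = sqrt (- H) * sqrt ((r - p) * (q - r)) / r" if "0 < r" for r
  proof -
    have "H * r\<^sup>2 + \<kappa> * r - (L\<^sup>2 - 2 * lam) / 2 = - H * ((r - p) * (q - r))"
      unfolding prod[symmetric] sum[symmetric] by (simp add: algebra_simps power2_eq_square)
    then have "H - eff_W \<kappa> lam L r = - H * ((r - p) * (q - r)) / r\<^sup>2"
      using W[OF that] by simp
    then show ?thesis
      using that by (simp only: real_sqrt_divide real_sqrt_mult) simp
  qed
qed

text \<open>The factorization turns the integrand into the first moment over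
  \<open>sqrt (- H)\<close>. Only the sum of the turning points enters, and that is
  \<open>\<kappa> / (- H)\<close>.\<close>

lemma radial_period_eq:
  fixes \<kappa> lam H L :: real
  assumes "\<kappa> > 0" "lam > 0" "(H, L) \<in> Lambda_dom \<kappa> lam"
  shows "radial_period \<kappa> lam H L = sqrt 2 / 2 * pi * \<kappa> * (- H) powr (- 3 / 2)"
proof -
  define p q where "p = r_minus \<kappa> lam H L" and "q = r_plus \<kappa> lam H L"
  note fac = turning_points_factorization[OF assms, folded p_def q_def]
  have H: "H < 0" using Lambda_dom_pos assms by blast
  have "((\<lambda>r. r / sqrt ((r - p) * (q - r)) / sqrt (- H)) has_integral
      pi * (p + q) / 2 / sqrt (- H)) {p..q}"
    by (intro has_integral_divide has_integral_arcsin_first_moment fac)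
  \<comment> \<open>This holds at the endpoints too: both sides are divisions by zero there and so
    equal 0.\<close>
  moreover have "1 / sqrt (H - eff_W \<kappa> lam L r) = r / sqrt ((r - p) * (q - r)) / sqrt (- H)"
    if "r \<in> {p..q}" for r
  proof -
    have "0 < r" using that fac(1) by simp
    then show ?thesis by (simp add: fac(5))
  qed
  ultimately have "((\<lambda>r. 1 / sqrt (H - eff_W \<kappa> lam L r)) has_integral
      pi * (p + q) / 2 / sqrt (- H)) {p..q}"
    by (subst has_integral_cong) auto
  then have "radial_period \<kappa> lam H L = sqrt 2 * (pi * (p + q) / 2 / sqrt (- H))"
    unfolding radial_period_def p_def[symmetric] q_def[symmetric]
    by (simp add: integral_unique)
  also have "p + q = \<kappa> / (- H)"
    using fac(3) H by (simp add: field_simps)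
  also have "sqrt 2 * (pi * (\<kappa> / (- H)) / 2 / sqrt (- H)) = sqrt 2 / 2 * pi * \<kappa> * (1 / ((- H) * sqrt (- H)))"
    by simp
  also have "(- H) * sqrt (- H) = (- H) powr (1 + 1 / 2)"
    using H by (subst powr_add) (simp add: powr_half_sqrt)
  also have "1 / (- H) powr (1 + 1 / 2) = (- H) powr (- 3 / 2)"
    by (simp add: powr_minus_divide)
  finally show ?thesis .
qed

text \<open>This is the inverse moment over \<open>sqrt (- H)\<close>. The two roots merge into
  \<open>sqrt (- H * (p * q))\<close>, and by Vieta the energy cancels.\<close>

lemma apsidal_angle_eq:
  fixes \<kappa> lam H L :: real
  assumes "\<kappa> > 0" "lam > 0" "(H, L) \<in> Lambda_dom \<kappa> lam"
  shows "apsidal_angle \<kappa> lam H L = 2 * pi * L * (L\<^sup>2 - 2 * lam) powr (- 1 / 2)"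
proof -
  define p q where "p = r_minus \<kappa> lam H L" and "q = r_plus \<kappa> lam H L"
  define m where "m = L\<^sup>2 - 2 * lam"
  note fac = turning_points_factorization[OF assms, folded p_def q_def m_def]
  have H: "H < 0" and m: "0 < m" using Lambda_dom_pos assms by (auto simp: m_def)
  have "((\<lambda>r. 1 / (r * sqrt ((r - p) * (q - r))) / sqrt (- H)) has_integral
      pi / sqrt (p * q) / sqrt (- H)) {p..q}"
    by (intro has_integral_divide has_integral_arcsin_inverse_moment fac)
  moreover have "1 / (r\<^sup>2 * sqrt (H - eff_W \<kappa> lam L r)) = 1 / (r * sqrt ((r - p) * (q - r))) / sqrt (- H)"
    if "r \<in> {p..q}" for r
  proof -
    have "0 < r" using that fac(1) by simp
    then show ?thesis by (simp add: fac(5) power2_eq_square)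
  qed
  ultimately have "((\<lambda>r. 1 / (r\<^sup>2 * sqrt (H - eff_W \<kappa> lam L r))) has_integral
      pi / sqrt (p * q) / sqrt (- H)) {p..q}"
    by (subst has_integral_cong) auto
  then have "apsidal_angle \<kappa> lam H L = sqrt 2 * L * (pi / sqrt (p * q) / sqrt (- H))"
    unfolding apsidal_angle_def p_def[symmetric] q_def[symmetric]
    by (simp add: integral_unique)
  also have "\<dots> = sqrt 2 * L * pi / sqrt (- H * (p * q))"
    by (simp only: real_sqrt_mult) simp
  also have "\<dots> = 2 * pi * L * (1 / sqrt m)"
    unfolding fac(4) by (simp add: real_sqrt_divide)
  also have "1 / sqrt m = m powr (- 1 / 2)"
    using m by (simp add: powr_minus_divide powr_half_sqrt)
  finally show ?thesis by (simp add: m_def)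
qed

section \<open>Partial derivatives and the Jacobian\<close>

theorem mainTheorem5:
  fixes \<kappa> lam :: real
  assumes "\<kappa> > 0" and "lam > 0"
  shows "\<forall>(H, L) \<in> Lambda_dom \<kappa> lam.
    (\<lambda>h. radial_period \<kappa> lam h L) differentiable at H \<and>
    (\<lambda>l. radial_period \<kappa> lam H l) differentiable at L \<and>
    (\<lambda>h. apsidal_angle \<kappa> lam h L) differentiable at H \<and>
    (\<lambda>l. apsidal_angle \<kappa> lam H l) differentiable at L \<and>
    deriv (\<lambda>h. radial_period \<kappa> lam h L) H * deriv (\<lambda>l. apsidal_angle \<kappa> lam H l) L
      - deriv (\<lambda>l. radial_period \<kappa> lam H l) L * deriv (\<lambda>h. apsidal_angle \<kappa> lam h L) H
      = - (3 * sqrt 2 * pi\<^sup>2 * \<kappa> * lam / ((- H) powr (5/2) * (L\<^sup>2 - 2 * lam) powr (3/2))) \<and>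
    - (3 * sqrt 2 * pi\<^sup>2 * \<kappa> * lam / ((- H) powr (5/2) * (L\<^sup>2 - 2 * lam) powr (3/2))) < 0"
proof safe
  fix H L assume HL: "(H, L) \<in> Lambda_dom \<kappa> lam"
  define m where "m = L\<^sup>2 - 2 * lam"
  note pos = Lambda_dom_pos[OF assms(2) HL]
  have m: "0 < m" using pos by (simp add: m_def)
  \<comment> \<open>Slices of the open domain are open, so along each variable the closed forms hold
    near the point and their derivatives carry over.\<close>
  have "open ((\<lambda>h. (h, L)) -` Lambda_dom \<kappa> lam)"
    by (intro open_vimage open_Lambda_dom assms continuous_intros)
  then have evH: "\<forall>\<^sub>F h in nhds H. (h, L) \<in> Lambda_dom \<kappa> lam"
    using HL by (auto simp: eventually_nhds)
  have "open ((\<lambda>l. (H, l)) -` Lambda_dom \<kappa> lam)"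
    by (intro open_vimage open_Lambda_dom assms continuous_intros)
  then have evL: "\<forall>\<^sub>F l in nhds L. (H, l) \<in> Lambda_dom \<kappa> lam"
    using HL by (auto simp: eventually_nhds)
  have TH: "((\<lambda>h. radial_period \<kappa> lam h L) has_real_derivative
      3 * sqrt 2 / 4 * pi * \<kappa> * (- H) powr (- 5 / 2)) (at H)"
  proof (subst DERIV_cong_ev[OF refl _ refl])
    show "\<forall>\<^sub>F h in nhds H. radial_period \<kappa> lam h L = sqrt 2 / 2 * pi * \<kappa> * (- h) powr (- 3 / 2)"
      using evH by eventually_elim (rule radial_period_eq[OF assms])
    show "((\<lambda>h. sqrt 2 / 2 * pi * \<kappa> * (- h) powr (- 3 / 2)) has_real_derivative
      3 * sqrt 2 / 4 * pi * \<kappa> * (- H) powr (- 5 / 2)) (at H)"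
      using pos by (auto intro!: derivative_eq_intros)
  qed
  have TL: "((\<lambda>l. radial_period \<kappa> lam H l) has_real_derivative 0) (at L)"
  proof (subst DERIV_cong_ev[OF refl _ refl])
    show "\<forall>\<^sub>F l in nhds L. radial_period \<kappa> lam H l = sqrt 2 / 2 * pi * \<kappa> * (- H) powr (- 3 / 2)"
      using evL by eventually_elim (rule radial_period_eq[OF assms])
  qed simp
  have AH: "((\<lambda>h. apsidal_angle \<kappa> lam h L) has_real_derivative 0) (at H)"
  proof (subst DERIV_cong_ev[OF refl _ refl])
    show "\<forall>\<^sub>F h in nhds H. apsidal_angle \<kappa> lam h L = 2 * pi * L * (L\<^sup>2 - 2 * lam) powr (- 1 / 2)"
      using evH by eventually_elim (rule apsidal_angle_eq[OF assms])
  qed simp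
  have AL: "((\<lambda>l. apsidal_angle \<kappa> lam H l) has_real_derivative
      - (4 * pi * lam * m powr (- 3 / 2))) (at L)"
  proof (subst DERIV_cong_ev[OF refl _ refl])
    show "\<forall>\<^sub>F l in nhds L. apsidal_angle \<kappa> lam H l = 2 * pi * l * (l\<^sup>2 - 2 * lam) powr (- 1 / 2)"
      using evL by eventually_elim (rule apsidal_angle_eq[OF assms])
    \<comment> \<open>With \<open>P\<close> factored out, the product rule leaves
      \<open>m - L\<^sup>2 = - 2 * lam\<close>; this is the source of the factor \<open>lam\<close>
      in the Jacobian.\<close>
    define P where "P = m powr (- 3 / 2)"
    have "m powr (- 1 / 2) = m * P"
      using m powr_add[of m 1 "- 3 / 2"] by (simp add: P_def)
    then have "2 * pi * m powr (- 1 / 2) - 2 * pi * L * L * P = 2 * pi * (m - L\<^sup>2) * P"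
      by (simp add: algebra_simps power2_eq_square)
    also have "\<dots> = - (4 * pi * lam * P)"
      by (simp add: m_def)
    finally have "2 * pi * m powr (- 1 / 2) - 2 * pi * L * L * m powr (- 3 / 2)
        = - (4 * pi * lam * m powr (- 3 / 2))"
      by (simp add: P_def)
    moreover have "((\<lambda>l. 2 * pi * l * (l\<^sup>2 - 2 * lam) powr (- 1 / 2)) has_real_derivative
      2 * pi * m powr (- 1 / 2) - 2 * pi * L * L * m powr (- 3 / 2)) (at L)"
      using pos(3) unfolding m_def by (auto intro!: derivative_eq_intros)
    ultimately show "((\<lambda>l. 2 * pi * l * (l\<^sup>2 - 2 * lam) powr (- 1 / 2)) has_real_derivative
      - (4 * pi * lam * m powr (- 3 / 2))) (at L)"
      by simp
  qed
  show "(\<lambda>h. radial_period \<kappa> lam h L) differentiable at H"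
    "(\<lambda>l. radial_period \<kappa> lam H l) differentiable at L"
    "(\<lambda>h. apsidal_angle \<kappa> lam h L) differentiable at H"
    "(\<lambda>l. apsidal_angle \<kappa> lam H l) differentiable at L"
    using TH TL AH AL real_differentiable_def by blast+
  show "deriv (\<lambda>h. radial_period \<kappa> lam h L) H * deriv (\<lambda>l. apsidal_angle \<kappa> lam H l) L
      - deriv (\<lambda>l. radial_period \<kappa> lam H l) L * deriv (\<lambda>h. apsidal_angle \<kappa> lam h L) H
      = - (3 * sqrt 2 * pi\<^sup>2 * \<kappa> * lam / ((- H) powr (5/2) * (L\<^sup>2 - 2 * lam) powr (3/2)))"
    \<comment> \<open>The second product is zero, and the constants of the first combine as
      \<open>3 * sqrt 2 / 4 * 4 = 3 * sqrt 2\<close>.\<close>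
    unfolding TH[THEN DERIV_imp_deriv] TL[THEN DERIV_imp_deriv]
      AH[THEN DERIV_imp_deriv] AL[THEN DERIV_imp_deriv] m_def[symmetric]
    by (simp add: powr_minus_divide power2_eq_square)
  show "- (3 * sqrt 2 * pi\<^sup>2 * \<kappa> * lam / ((- H) powr (5/2) * (L\<^sup>2 - 2 * lam) powr (3/2))) < 0"
    using assms pos by simp
qed

end
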